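(* Let $p\ge 1$ be an integer and let $\mathcal{A}=\{A_\theta : \theta\in\mathcal{O}\}$ be a parametric family of Pickands dependence functions such that: (A) the parameter space $\mathcal{O}$ is an open subset of $\mathbb{R}^p$; (B) for every $\theta\in\mathcal{O}$, $A_\theta$ is twice continuously differentiable on $(0,1)$; (C) for every $\theta\in\mathcal{O}$, the gradient $\dot A_\theta(t)$ of $A_\theta(t)$ with respect to $\theta$ satisfies $$\lim_{\epsilon\downarrow 0}\ \sup_{\|\theta^*-\theta\|<\epsilon}\ \sup_{t\in[0,1]}\|\dot A_{\theta^*}(t)-\dot A_\theta(t)\| = 0 ,$$ where $\|\cdot\|$ is the $\ell_2$-norm. Let $(X_1,Y_1),\ldots,(X_n,Y_n)$ be a random sample from a bivariate distribution with continuous margins whose copula $C$ is an extreme-value copula with Pickands dependence function $A=A_{\theta_0}$ for some $\theta_0\in\mathcal{O}$. Let $\theta_n$ be a rank-based, $\mathcal{O}$-valued estimator of $\theta_0$ and set $\Theta_n=\sqrt{n}(\theta_n-\theta_0)$. Let $A_n^{\mathrm{P}}$, $A_n^{\mathrm{CFG}}$ be the rank-based nonparametric estimators of $A$ defined in the context, and put $\mathbb{A}_n^{\mathrm{P}}=\sqrt{n}(A_n^{\mathrm{P}}-A)$ and $\mathbb{A}_n^{\mathrm{CFG}}=\sqrt{n}(A_n^{\mathrm{CFG}}-A)$. (a) If $(\mathbb{A}_n^{\mathrm{P}},\Theta_n)$ converges weakly to a Gaussian limit $(\mathbb{A}^{\mathrm{P}},\Theta)$ as $n\to\infty$, then $$\sqrt{n}\,(A_n^{\mathrm{P}}-A_{\theta_n})\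 \rightsquigarrow\ \mathbb{A}^{\mathrm{P}}-\dot A_{\theta_0}^\top\Theta\quad\text{as } n\to\infty \text{ in } \mathcal{C}[0,1].$$ (b) If $(\mathbb{A}_n^{\mathrm{CFG}},\Theta_n)$ converges weakly to a Gaussian limit $(\mathbb{A}^{\mathrm{CFG}},\Theta)$ as $n\to\infty$, then $$\sqrt{n}\,(A_n^{\mathrm{CFG}}-A_{\theta_n})\ \rightsquigarrow\ \mathbb{A}^{\mathrm{CFG}}-\dot A_{\theta_0}^\top\Theta\quad\text{as } n\to\infty \text{ in } \mathcal{C}[0,1].$$
   Context: A Pickands dependence function is a convex map $A:[0,1]\to[1/2,1]$ with $\max(t,1-t)\le A(t)\le 1$ for all $t\in[0,1]$. The (bivariate) extreme-value copula with Pickands dependence function $A$ is given by $C(u,v)=\exp[\log(uv)\,A\{\log(v)/\log(uv)\}]$ for $u,v\in(0,1)$. The copula of a pair $(X,Y)$ with continuous margins $F,G$ is the joint distribution function of $(F(X),G(Y))$. Normalized ranks: $U_i=F_n(X_i)$, $V_i=G_n(Y_i)$, where $F_n(x)=\frac{1}{n+1}\sum_{i=1}^n\mathbf{1}(X_i\le x)$ and $G_n(y)=\frac{1}{n+1}\sum_{i=1}^n\mathbf{1}(Y_i\le y)$. "Rank-based" means a function of $(U_1,V_1),\ldots,(U_n,V_n)$. For $i\in\{1,\ldots,n\}$ let $\xi_i(0)=-\log U_i$, $\xi_i(1)=-\log V_i$ and, for $t\in(0,1)$, $\xi_i(t)=\min\{-\log(U_i)/(1-t),\,-\log(V_i)/t\}$.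 The estimators are $$A_n^{\mathrm{P}}(t)=1\Big/\Big\{\frac1n\sum_{i=1}^n\xi_i(t)\Big\},\qquad A_n^{\mathrm{CFG}}(t)=\exp\Big[-\gamma-\frac1n\sum_{i=1}^n\log\{\xi_i(t)\}\Big],\quad t\in[0,1],$$ where $\gamma=-\int_0^\infty\log(x)e^{-x}\,dx$ is Euler's constant. $\rightsquigarrow$ denotes weak convergence (convergence in law); $\mathcal{C}[0,1]$ is the space of continuous functions on $[0,1]$ with the supremum norm. The joint convergence hypotheses are in $\mathcal{C}[0,1]\times\mathbb{R}^p$. The limits are (jointly Gaussian) $\mathbb{A}^{\mathrm{P}}$, $\mathbb{A}^{\mathrm{CFG}}$ with $$\mathbb{A}^{\mathrm{P}}(t)=-A^2(t)\int_0^1\mathbb{C}(x^{1-t},x^t)\frac{dx}{x},\qquad \mathbb{A}^{\mathrm{CFG}}(t)=A(t)\int_0^1\mathbb{C}(x^{1-t},x^t)\frac{dx}{x\log x},$$ where $\mathbb{C}$ is the Gaussian weak limit of the empirical copula process $\sqrt n(C_n-C)$, $C_n(u,v)=\frac1n\sum_{i=1}^n\mathbf{1}(U_i\le u,V_i\le v)$. *)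

theory Defs
  imports "HOL-Probability.Probability"
begin

subsection \<open>The spaces of sample paths\<close>

typedef unit_interval = "{0..1::real}"
  morphisms of_ui ui
  by (rule exI[of _ 0]) simp

instantiation unit_interval :: metric_space
begin

definition dist_unit_interval :: "unit_interval \<Rightarrow> unit_interval \<Rightarrow> real"
  where "dist_unit_interval s t = dist (of_ui s) (of_ui t)"

definition uniformity_unit_interval :: "(unit_interval \<times> unit_interval) filter" where
  "uniformity_unit_interval = (INF e\<in>{0 <..}. principal {(x, y). dist x y < e})"

definition open_unit_interval :: "unit_interval set \<Rightarrow> bool" where
  "open_unit_interval S = (\<forall>x\<in>S. \<forall>\<^sub>F (x', y) in uniformity. x' = x \<longrightarrow> y \<in> S)"

instance
proof
  fix s t r :: unit_interval
  show "dist s t = 0 \<longleftrightarrow> s = t"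
    by (simp add: dist_unit_interval_def of_ui_inject)
  show "dist s t \<le> dist s r + dist t r"
    unfolding dist_unit_interval_def by (rule dist_triangle2)
qed (rule open_unit_interval_def uniformity_unit_interval_def)+

end

lemma continuous_on_of_ui: "continuous_on S of_ui"
  unfolding continuous_on_iff by (auto simp: dist_unit_interval_def)

lemma continuous_on_ui: "continuous_on {0..1} ui"
  unfolding continuous_on_iff by (auto simp: dist_unit_interval_def ui_inverse)

lemma compact_UNIV_unit_interval: "compact (UNIV :: unit_interval set)"
proof -
  have "UNIV = ui ` {0..1}"
    by (metis of_ui of_ui_inverse UNIV_eq_I image_eqI)
  then show ?thesis
    by (metis compact_continuous_image[OF continuous_on_ui compact_Icc])
qed

text \<open>
  \<open>C01\<close> is the Banach space of continuous functions on $[0,1]$ with the supremum norm.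
  \<open>linf_square\<close> is the Banach space of all bounded functions on $[0,1]^2$ with the supremum
  norm: the discrete topology on the index set makes the continuity requirement of
  \<open>\<Rightarrow>\<^sub>C\<close> void.
\<close>

type_synonym C01 = "unit_interval \<Rightarrow>\<^sub>C real"
type_synonym linf_square = "(unit_interval \<times> unit_interval) discrete \<Rightarrow>\<^sub>C real"

definition to_C01 :: "(real \<Rightarrow> real) \<Rightarrow> C01" where
  "to_C01 f = Bcontfun (\<lambda>s. f (of_ui s))"

definition to_linf_square :: "(real \<Rightarrow> real \<Rightarrow> real) \<Rightarrow> linf_square" where
  "to_linf_square f =
    Bcontfun (\<lambda>p. f (of_ui (fst (of_discrete p))) (of_ui (snd (of_discrete p))))"

definition eval_C01 :: "C01 \<Rightarrow> real \<Rightarrow> real" where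
  "eval_C01 z t = apply_bcontfun z (ui t)"

definition eval_linf_square :: "linf_square \<Rightarrow> real \<Rightarrow> real \<Rightarrow> real" where
  "eval_linf_square z u v = apply_bcontfun z (discrete (ui u, ui v))"

lemma eval_to_C01:
  assumes "continuous_on {0..1} f" "t \<in> {0..1}"
  shows "eval_C01 (to_C01 f) t = f t"
proof -
  have c: "continuous_on UNIV (\<lambda>s. f (of_ui s))"
    by (rule continuous_on_compose2[OF assms(1) continuous_on_of_ui]) (use of_ui in auto)
  have "bounded (range (\<lambda>s. f (of_ui s)))"
    by (rule compact_imp_bounded[OF compact_continuous_image[OF c compact_UNIV_unit_interval]])
  with c show ?thesis
    using assms(2) by (simp add: eval_C01_def to_C01_def Bcontfun_inverse bcontfun_def ui_inverse)
qed

lemma eval_to_linf_square: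
  assumes "\<And>u v. u \<in> {0..1} \<Longrightarrow> v \<in> {0..1} \<Longrightarrow> \<bar>f u v\<bar> \<le> B" "u \<in> {0..1}" "v \<in> {0..1}"
  shows "eval_linf_square (to_linf_square f) u v = f u v"
proof -
  let ?g = "\<lambda>p. f (of_ui (fst (of_discrete p))) (of_ui (snd (of_discrete p)))"
  have "bounded (range ?g)"
    by (rule boundedI[of _ B]) (use assms(1)[OF of_ui of_ui] in auto)
  moreover have "continuous_on UNIV ?g"
    by (simp add: continuous_on_open_vimage open_discrete)
  ultimately show ?thesis
    using assms(2,3)
    by (simp add: eval_linf_square_def to_linf_square_def Bcontfun_inverse bcontfun_def
        ui_inverse discrete_inverse)
qed


subsection \<open>Weak convergence and Gaussian random elements\<close>

definition conv_in_law ::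
    "'a measure \<Rightarrow> (nat \<Rightarrow> 'a \<Rightarrow> 'b::metric_space) \<Rightarrow> 'c measure \<Rightarrow> ('c \<Rightarrow> 'b) \<Rightarrow> bool" where
  "conv_in_law M Z N L \<longleftrightarrow>
    (\<forall>n. Z n \<in> borel_measurable M) \<and> L \<in> borel_measurable N \<and>
    (\<forall>h :: 'b \<Rightarrow> real. continuous_on UNIV h \<longrightarrow> bounded (range h) \<longrightarrow>
      (\<lambda>n. \<integral>\<omega>. h (Z n \<omega>) \<partial>M) \<longlonglongrightarrow> (\<integral>\<omega>. h (L \<omega>) \<partial>N))"

text \<open>Degenerate normal laws (variance zero) are included.\<close>

definition normal_law :: "real measure \<Rightarrow> bool" where
  "normal_law \<mu> \<longleftrightarrow>
    (\<exists>m \<sigma>. \<sigma> > 0 \<and> \<mu> = density lborel (normal_density m \<sigma>)) \<or> (\<exists>m. \<mu> = return borel m)"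

definition gaussian :: "'a measure \<Rightarrow> ('a \<Rightarrow> 'b::real_normed_vector) \<Rightarrow> bool" where
  "gaussian N L \<longleftrightarrow> L \<in> borel_measurable N \<and>
    (\<forall>\<phi> :: 'b \<Rightarrow> real. bounded_linear \<phi> \<longrightarrow> normal_law (distr N borel (\<lambda>\<omega>. \<phi> (L \<omega>))))"


subsection \<open>Extreme-value copulas\<close>

definition pickands :: "(real \<Rightarrow> real) \<Rightarrow> bool" where
  "pickands A \<longleftrightarrow> convex_on {0..1} A \<and> A ` {0..1} \<subseteq> {1/2..1} \<and>
    (\<forall>t\<in>{0..1}. max t (1 - t) \<le> A t \<and> A t \<le> 1)"

definition copula_of :: "'a measure \<Rightarrow> ('a \<Rightarrow> real) \<Rightarrow> ('a \<Rightarrow> real) \<Rightarrow> real \<Rightarrow> real \<Rightarrow> real" where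
  "copula_of M X Y u v =
    measure M {\<omega> \<in> space M. cdf (distr M borel X) (X \<omega>) \<le> u \<and> cdf (distr M borel Y) (Y \<omega>) \<le> v}"

definition extreme_value_copula :: "(real \<Rightarrow> real \<Rightarrow> real) \<Rightarrow> (real \<Rightarrow> real) \<Rightarrow> bool" where
  "extreme_value_copula C A \<longleftrightarrow>
    (\<forall>u\<in>{0<..<1}. \<forall>v\<in>{0<..<1}. C u v = exp (ln (u * v) * A (ln v / ln (u * v))))"

definition twice_cont_diff_on :: "real set \<Rightarrow> (real \<Rightarrow> real) \<Rightarrow> bool" where
  "twice_cont_diff_on S f \<longleftrightarrow>
    (\<exists>f' f''. (\<forall>t\<in>S. (f has_real_derivative f' t) (at t)) \<and>
      (\<forall>t\<in>S. (f' has_real_derivative f'' t) (at t)) \<and> continuous_on S f'')"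


subsection \<open>Rank-based estimators\<close>

text \<open>A sample of size \<open>n\<close> is given by its values at the indices \<open>1, \<dots>, n\<close>.\<close>

definition resc_edf :: "nat \<Rightarrow> (nat \<Rightarrow> real) \<Rightarrow> real \<Rightarrow> real" where
  "resc_edf n x s = 1 / (real n + 1) * (\<Sum>i=1..n. of_bool (x i \<le> s))"

definition norm_rank :: "nat \<Rightarrow> (nat \<Rightarrow> real) \<Rightarrow> nat \<Rightarrow> real" where
  "norm_rank n x i = resc_edf n x (x i)"

definition rank_pairs :: "nat \<Rightarrow> (nat \<Rightarrow> real) \<Rightarrow> (nat \<Rightarrow> real) \<Rightarrow> (real \<times> real) list" where
  "rank_pairs n x y = map (\<lambda>i. (norm_rank n x i, norm_rank n y i)) [1..<Suc n]"

text \<open>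
  No measurability is required of \<open>T\<close>: the normalized ranks of a sample of size \<open>n\<close> take
  only finitely many values.
\<close>

definition rank_based ::
    "'a measure \<Rightarrow> (nat \<Rightarrow> 'a \<Rightarrow> real) \<Rightarrow> (nat \<Rightarrow> 'a \<Rightarrow> real) \<Rightarrow> (nat \<Rightarrow> 'a \<Rightarrow> 'b) \<Rightarrow> bool" where
  "rank_based M X Y est \<longleftrightarrow>
    (\<exists>T. \<forall>n\<ge>1. \<forall>\<omega>\<in>space M. est n \<omega> = T n (rank_pairs n (\<lambda>i. X i \<omega>) (\<lambda>i. Y i \<omega>)))"

definition xi :: "real \<Rightarrow> real \<Rightarrow> real \<Rightarrow> real" where
  "xi u v t =
    (if t = 0 then - ln u else if t = 1 then - ln v else min (- ln u / (1 - t)) (- ln v / t))"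

definition A_P :: "nat \<Rightarrow> (nat \<Rightarrow> real) \<Rightarrow> (nat \<Rightarrow> real) \<Rightarrow> real \<Rightarrow> real" where
  "A_P n x y t = 1 / (1 / real n * (\<Sum>i=1..n. xi (norm_rank n x i) (norm_rank n y i) t))"

definition A_CFG :: "nat \<Rightarrow> (nat \<Rightarrow> real) \<Rightarrow> (nat \<Rightarrow> real) \<Rightarrow> real \<Rightarrow> real" where
  "A_CFG n x y t =
    exp (- euler_mascheroni - 1 / real n * (\<Sum>i=1..n. ln (xi (norm_rank n x i) (norm_rank n y i) t)))"

definition emp_copula :: "nat \<Rightarrow> (nat \<Rightarrow> real) \<Rightarrow> (nat \<Rightarrow> real) \<Rightarrow> real \<Rightarrow> real \<Rightarrow> real" where
  "emp_copula n x y u v =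
    1 / real n * (\<Sum>i=1..n. of_bool (norm_rank n x i \<le> u \<and> norm_rank n y i \<le> v))"

text \<open>
  The following facts show that the sample paths fed to \<^const>\<open>to_C01\<close> are indeed continuous on
  the closed unit interval, so that no unspecified value of \<^const>\<open>Bcontfun\<close> is involved.
\<close>

lemma pickands_continuous:
  assumes "pickands A"
  shows "continuous_on {0..1} A"
proof -
  have cv: "convex_on {0..1} A" and lo: "\<And>t. t \<in> {0..1} \<Longrightarrow> max t (1 - t) \<le> A t"
    and hi: "\<And>t. t \<in> {0..1} \<Longrightarrow> A t \<le> 1"
    using assms by (auto simp: pickands_def)
  have "convex_on {0<..<1} A"
    by (rule convex_on_subset[OF cv]) auto
  then have inner: "continuous_on {0<..<1} A"
    by (intro convex_on_continuous) auto
  have ends: "continuous (at s within {0..1}) A" if s: "s = 0 \<or> s = 1" for s :: real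
  proof -
    have ev: "\<forall>\<^sub>F t in at s within {0..1}. t \<in> {0..1}"
      by (simp add: eventually_at_filter)
    have "((\<lambda>t. max t (1 - t)) \<longlongrightarrow> max s (1 - s)) (at s within {0..1})"
      by (intro tendsto_intros)
    moreover have "max s (1 - s) = 1"
      using s by auto
    ultimately have "((\<lambda>t. max t (1 - t)) \<longlongrightarrow> 1) (at s within {0..1})"
      by simp
    then have "(A \<longlongrightarrow> 1) (at s within {0..1})"
      by (rule tendsto_sandwich[rotated 2])
        (use ev lo hi in \<open>auto elim!: eventually_mono\<close>)
    moreover have "A s = 1"
      using s lo[of s] hi[of s] by auto
    ultimately show ?thesis
      by (simp add: continuous_within)
  qed
  have "continuous (at s within {0..1}) A" if "s \<in> {0..1}" for s
  proof (cases "s = 0 \<or> s = 1")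
    case False
    with that have "s \<in> {0<..<1}" by auto
    then have "isCont A s"
      using inner by (simp add: continuous_on_eq_continuous_at)
    then show ?thesis
      by (rule continuous_at_imp_continuous_at_within)
  qed (rule ends)
  then show ?thesis
    by (simp add: continuous_on_eq_continuous_within)
qed

lemma norm_rank_bounds:
  assumes "i \<in> {1..n}"
  shows "0 < norm_rank n x i" "norm_rank n x i < 1"
proof -
  have "(\<Sum>j\<in>{i}. of_bool (x j \<le> x i) :: real) \<le> (\<Sum>j=1..n. of_bool (x j \<le> x i))"
    by (rule sum_mono2) (use assms in auto)
  then show "0 < norm_rank n x i"
    by (simp add: norm_rank_def resc_edf_def)
  have "(\<Sum>j=1..n. of_bool (x j \<le> x i) :: real) \<le> (\<Sum>j=1..n. 1)"
    by (rule sum_mono) auto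
  then show "norm_rank n x i < 1"
    by (simp add: norm_rank_def resc_edf_def divide_simps)
qed

lemma xi_continuous:
  assumes "0 < u" "u < 1" "0 < v" "v < 1"
  shows "continuous_on {0..1} (xi u v)" "\<And>t. t \<in> {0..1} \<Longrightarrow> 0 < xi u v t"
proof -
  define a b where "a = - ln u" and "b = - ln v"
  have ab: "a > 0" "b > 0"
    using assms by (auto simp: a_def b_def)
  have m: "max ((1 - t) / a) (t / b) > 0" if "t \<in> {0..1}" for t
    using that ab by (cases "t = 0") (auto simp: less_max_iff_disj)
  have eq: "xi u v t = 1 / max ((1 - t) / a) (t / b)" if t: "t \<in> {0..1}" for t
  proof -
    consider "t = 0" | "t = 1" | "0 < t" "t < 1"
      using t by fastforce
    then show ?thesis
    proof cases
      case 3
      have "xi u v t = min (a / (1 - t)) (b / t)"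
        using 3 by (simp add: xi_def a_def b_def)
      also have "\<dots> = 1 / max ((1 - t) / a) (t / b)"
        using 3 ab by (auto simp: min_def max_def field_simps)
      finally show ?thesis .
    qed (use ab in \<open>auto simp: xi_def a_def[symmetric] b_def[symmetric]\<close>)
  qed
  have "continuous_on {0..1} (\<lambda>t. 1 / max ((1 - t) / a) (t / b))"
    using ab m by (intro continuous_intros ballI) (simp_all add: less_imp_neq[symmetric])
  then show "continuous_on {0..1} (xi u v)"
    by (rule continuous_on_eq) (simp add: eq)
  show "0 < xi u v t" if "t \<in> {0..1}" for t
    using eq[OF that] m[OF that] by simp
qed

lemma A_P_continuous: "continuous_on {0..1} (A_P n x y)"
proof (cases "n = 0")
  case False
  have "(\<Sum>i=1..n. xi (norm_rank n x i) (norm_rank n y i) t) > 0" if "t \<in> {0..1}" for t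
    using False that by (intro sum_pos xi_continuous norm_rank_bounds) auto
  then have "\<forall>t\<in>{0..1}. 1 / real n * (\<Sum>i=1..n. xi (norm_rank n x i) (norm_rank n y i) t) \<noteq> 0"
    using False by (metis less_irrefl mult_pos_pos of_nat_0_less_iff neq0_conv zero_less_divide_1_iff)
  then show ?thesis
    unfolding A_P_def
    by (intro continuous_on_divide continuous_on_mult continuous_on_sum continuous_on_const
        xi_continuous norm_rank_bounds)
qed (simp add: A_P_def)

lemma A_CFG_continuous: "continuous_on {0..1} (A_CFG n x y)"
proof -
  have "xi (norm_rank n x i) (norm_rank n y i) t > 0" if "t \<in> {0..1}" "i \<in> {1..n}" for t i
    using that by (intro xi_continuous norm_rank_bounds) auto
  then have "\<forall>t\<in>{0..1}. xi (norm_rank n x i) (norm_rank n y i) t \<noteq> 0" if "i \<in> {1..n}" for i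
    using that by fastforce
  then show ?thesis
    unfolding A_CFG_def
    by (intro continuous_on_exp continuous_on_diff continuous_on_ln continuous_on_mult
        continuous_on_sum continuous_on_const xi_continuous norm_rank_bounds)
qed

end

theory Submission
  imports Defs
begin

text \<open>
  Condition (C) makes $\theta \mapsto A_\theta$ Fr\'echet differentiable as a map into
  $\mathcal{C}[0,1]$, with derivative $h \mapsto \dot A_\theta^\top h$. Hence the maps
  $g_n(z,h) = z - \sqrt n\,(A_{\theta_0 + h/\sqrt n} - A_{\theta_0})$ converge continuously to
  $g(z,h) = z - \dot A_{\theta_0}^\top h$, and the claim is the extended continuous mapping theorem
  applied to $g_n(\mathbb{A}_n, \Theta_n)$. That theorem is obtained without tightness or
  separability: for a bounded continuous function \<open>f\<close>, the Lipschitz functions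
  $w \mapsto \inf_{n \ge k,\, w'} \{f(g_n(w')) + k\,d(w', w)\}$ lie below $f \circ g_n$
  for $n \ge k$ and converge pointwise to $f \circ g$.
\<close>

subsection \<open>The extended continuous mapping theorem\<close>

text \<open>This is the Pasch-Hausdorff envelope (infimal convolution with \<open>k * dist\<close>)
  of the tail infimum of \<open>f n\<close> over \<open>n \<ge> k\<close>. One index
  \<open>k\<close> serves both as tail cutoff and as Lipschitz constant, so a single limit in
  \<open>k\<close> recovers the limit function.\<close>

definition lower_envelope :: "(nat \<Rightarrow> 'b::metric_space \<Rightarrow> real) \<Rightarrow> nat \<Rightarrow> 'b \<Rightarrow> real" where
  "lower_envelope f k w = (INF p\<in>{k..} \<times> UNIV. f (fst p) (snd p) + real k * dist (snd p) w)"

context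
  fixes f :: "nat \<Rightarrow> 'b::metric_space \<Rightarrow> real" and B :: real
  assumes bound: "\<And>n w. \<bar>f n w\<bar> \<le> B"
begin

lemma lower_envelope_bdd:
  "bdd_below ((\<lambda>p. f (fst p) (snd p) + real k * dist (snd p) w) ` ({k..} \<times> UNIV))"
proof (rule bdd_belowI2)
  show "- B \<le> f (fst p) (snd p) + real k * dist (snd p) w" for p
    by (rule add_increasing2) (use bound[of "fst p" "snd p"] in \<open>auto simp: abs_le_iff\<close>)
qed

lemma lower_envelope_le:
  assumes "k \<le> n"
  shows "lower_envelope f k w \<le> f n w' + real k * dist w' w"
  unfolding lower_envelope_def
  using cINF_lower[OF lower_envelope_bdd, of "(n, w')" k w] assms by simp

lemma lower_envelope_ge:
  assumes "\<And>n w'. k \<le> n \<Longrightarrow> c \<le> f n w' + real k * dist w' w"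
  shows "c \<le> lower_envelope f k w"
  unfolding lower_envelope_def by (rule cINF_greatest) (use assms in auto)

lemma abs_lower_envelope_le: "\<bar>lower_envelope f k w\<bar> \<le> B"
proof -
  have "lower_envelope f k w \<le> B"
    using lower_envelope_le[of k k w w] bound[of k w] by simp
  moreover have "- B \<le> lower_envelope f k w"
  proof (rule lower_envelope_ge)
    show "- B \<le> f n w' + real k * dist w' w" for n w'
      by (rule add_increasing2) (use bound[of n w'] in \<open>auto simp: abs_le_iff\<close>)
  qed
  ultimately show ?thesis by simp
qed

text \<open>By the triangle inequality every term of the infimum is \<open>k\<close>-Lipschitz in
  \<open>w\<close>, and an infimum of such terms keeps the constant.\<close>

lemma lower_envelope_lipschitz:
  "lower_envelope f k w \<le> lower_envelope f k v + real k * dist v w"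
proof -
  have "lower_envelope f k w - real k * dist v w \<le> lower_envelope f k v"
  proof (rule lower_envelope_ge)
    fix n w' assume "k \<le> n"
    then have "lower_envelope f k w \<le> f n w' + real k * dist w' w"
      by (rule lower_envelope_le)
    also have "\<dots> \<le> f n w' + real k * (dist w' v + dist v w)"
      by (intro add_left_mono mult_left_mono dist_triangle) simp
    finally show "lower_envelope f k w - real k * dist v w \<le> f n w' + real k * dist w' v"
      by (simp add: algebra_simps)
  qed
  then show ?thesis by simp
qed

lemma continuous_on_lower_envelope: "continuous_on UNIV (lower_envelope f k)"
proof (rule lipschitz_on_continuous_on[of "real k"], rule lipschitz_onI)
  show "dist (lower_envelope f k v) (lower_envelope f k w) \<le> real k * dist v w" for v w
    using lower_envelope_lipschitz[of k v w] lower_envelope_lipschitz[of k w v]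
    by (simp add: dist_real_def dist_commute abs_le_iff)
qed simp

text \<open>The product filter expresses continuous convergence: \<open>f n w'\<close> is close to
  \<open>l\<close> once \<open>n\<close> is large and \<open>w'\<close> is near \<open>w\<close>.
  Points near \<open>w\<close> therefore cannot pull the infimum much below \<open>l\<close>, and
  distant points pay a penalty that eventually exceeds the range of \<open>f\<close>. The upper
  bound comes from the admissible pair \<open>(k, w)\<close>.\<close>

lemma lower_envelope_tendsto:
  assumes "((\<lambda>(n, w'). f n w') \<longlongrightarrow> l) (sequentially \<times>\<^sub>F nhds w)"
  shows "(\<lambda>k. lower_envelope f k w) \<longlonglongrightarrow> l"
proof (rule LIMSEQ_I)
  fix e :: real assume "e > 0"
  then have "\<forall>\<^sub>F p in sequentially \<times>\<^sub>F nhds w. \<bar>f (fst p) (snd p) - l\<bar> < e / 2"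
    using tendstoD[OF assms, of "e / 2"] by (simp add: dist_real_def split_beta)
  then obtain P Q where P: "eventually P sequentially" and Q: "eventually Q (nhds w)"
    and PQ: "\<And>n w'. P n \<Longrightarrow> Q w' \<Longrightarrow> \<bar>f n w' - l\<bar> < e / 2"
    unfolding eventually_prod_filter by auto
  obtain K where K: "\<And>n. n \<ge> K \<Longrightarrow> P n"
    using P by (auto simp: eventually_sequentially)
  obtain d where d: "d > 0" "\<And>w'. dist w' w < d \<Longrightarrow> Q w'"
    using Q by (auto simp: eventually_nhds_metric)
  have near: "\<bar>f n w' - l\<bar> < e / 2" if "n \<ge> K" "dist w' w < d" for n w'
    using K[OF that(1)] d(2)[OF that(2)] by (rule PQ)
  have "\<bar>f K w - l\<bar> < e / 2"
    using near[of K w] d(1) by simp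
  then have "l \<le> B + e / 2"
    using bound[of K w] by linarith
  \<comment> \<open>For \<open>w'\<close> at distance at least \<open>d\<close> from
    \<open>w\<close>, the penalty is then at least \<open>2 * B\<close>; it lifts any value, even
    \<open>- B\<close>, to at least \<open>B\<close>, hence to at least
    \<open>l - e / 2\<close>.\<close>
  obtain K' where K': "real K' * d \<ge> 2 * B"
    using ex_less_of_nat_mult[OF d(1)] by (metis less_imp_le)
  show "\<exists>k0. \<forall>k\<ge>k0. norm (lower_envelope f k w - l) < e"
  proof (intro exI[of _ "max K K'"] allI impI)
    fix k assume k: "k \<ge> max K K'"
    have "l - e / 2 \<le> lower_envelope f k w"
    proof (rule lower_envelope_ge)
      fix n w' assume n: "k \<le> n"
      show "l - e / 2 \<le> f n w' + real k * dist w' w"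
      proof (cases "dist w' w < d")
        case True
        then have "\<bar>f n w' - l\<bar> < e / 2"
          using k n by (intro near) auto
        moreover have "0 \<le> real k * dist w' w"
          by simp
        ultimately show ?thesis by linarith
      next
        case False
        then have "real K' * d \<le> real k * dist w' w"
          using k d(1) by (intro mult_mono) auto
        then show ?thesis
          using K' \<open>l \<le> B + e / 2\<close> bound[of n w'] by (simp add: abs_le_iff)
      qed
    qed
    moreover have "lower_envelope f k w \<le> f k w"
      using lower_envelope_le[of k k w w] by simp
    moreover have "\<bar>f k w - l\<bar> < e / 2"
      using near[of k w] k d(1) by simp
    ultimately have "\<bar>lower_envelope f k w - l\<bar> < e"
      using \<open>e > 0\<close> by linarith
    then show "norm (lower_envelope f k w - l) < e"
      by simp
  qed
qed

end

section \<open>Passage to expectations\<close>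

lemma (in prob_space) integrable_bounded_real:
  fixes f :: "'a \<Rightarrow> real"
  assumes "f \<in> borel_measurable M" "\<And>x. \<bar>f x\<bar> \<le> B"
  shows "integrable M f"
  by (rule integrable_const_bound[of _ B]) (use assms in auto)

text \<open>A fixed envelope is bounded and continuous, hence an admissible test function for the
  assumed weak convergence, and it minorizes \<open>f n\<close> for all \<open>n \<ge> k\<close>.
  This yields the lower half of the convergence of expectations.\<close>

lemma conv_in_law_extended_lower:
  fixes W :: "nat \<Rightarrow> 'a \<Rightarrow> 'b::metric_space" and f :: "nat \<Rightarrow> 'b \<Rightarrow> real"
  assumes prob: "prob_space M" "prob_space N"
    and conv: "conv_in_law M W N L"
    and bound: "\<And>n w. \<bar>f n w\<bar> \<le> B"
    and meas: "\<And>n. (\<lambda>\<omega>. f n (W n \<omega>)) \<in> borel_measurable M"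
    and lim: "\<And>w. ((\<lambda>(n, w'). f n w') \<longlongrightarrow> g w) (sequentially \<times>\<^sub>F nhds w)"
    and gm: "(\<lambda>\<omega>. g (L \<omega>)) \<in> borel_measurable N"
    and e: "e > 0"
  shows "\<forall>\<^sub>F n in sequentially. (\<integral>\<omega>. g (L \<omega>) \<partial>N) - e < (\<integral>\<omega>. f n (W n \<omega>) \<partial>M)"
proof -
  interpret M: prob_space M by fact
  interpret N: prob_space N by fact
  define \<phi> where "\<phi> = lower_envelope f"
  have \<phi>_cont: "continuous_on UNIV (\<phi> k)" and \<phi>_bound: "\<bar>\<phi> k w\<bar> \<le> B"
    and \<phi>_le: "k \<le> n \<Longrightarrow> \<phi> k w \<le> f n w" and \<phi>_lim: "(\<lambda>k. \<phi> k w) \<longlonglongrightarrow> g w" for k w n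
    unfolding \<phi>_def
    using continuous_on_lower_envelope[of f B] abs_lower_envelope_le[of f B]
      lower_envelope_le[of f B k n w w] lower_envelope_tendsto[of f B "g w" w, OF _ lim] bound
    by auto
  have Wm: "W n \<in> borel_measurable M" and Lm: "L \<in> borel_measurable N" for n
    using conv by (auto simp: conv_in_law_def)
  have \<phi>W: "(\<lambda>\<omega>. \<phi> k (W n \<omega>)) \<in> borel_measurable M" for k n
    using measurable_compose[OF Wm borel_measurable_continuous_onI[OF \<phi>_cont]] .
  have \<phi>L: "(\<lambda>\<omega>. \<phi> k (L \<omega>)) \<in> borel_measurable N" for k
    using measurable_compose[OF Lm borel_measurable_continuous_onI[OF \<phi>_cont]] .
  \<comment> \<open>Order of limits: dominated convergence under the limit law fixes
    \<open>k\<close> first; only afterwards does \<open>n\<close> tend to infinity with that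
    \<open>k\<close>.\<close>
  have "(\<lambda>k. \<integral>\<omega>. \<phi> k (L \<omega>) \<partial>N) \<longlonglongrightarrow> (\<integral>\<omega>. g (L \<omega>) \<partial>N)"
    by (rule integral_dominated_convergence[where w = "\<lambda>_. B"])
      (use gm \<phi>L \<phi>_lim \<phi>_bound in auto)
  from order_tendstoD(1)[OF this, of "(\<integral>\<omega>. g (L \<omega>) \<partial>N) - e"] e
  obtain k where k: "(\<integral>\<omega>. g (L \<omega>) \<partial>N) - e < (\<integral>\<omega>. \<phi> k (L \<omega>) \<partial>N)"
    by (auto simp: eventually_sequentially)
  have "bounded (range (\<phi> k))"
    by (rule boundedI[of _ B]) (use \<phi>_bound in auto)
  with conv \<phi>_cont have "(\<lambda>n. \<integral>\<omega>. \<phi> k (W n \<omega>) \<partial>M) \<longlonglongrightarrow> (\<integral>\<omega>. \<phi> k (L \<omega>) \<partial>N)"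
    by (auto simp: conv_in_law_def)
  from order_tendstoD(1)[OF this k] eventually_ge_at_top[of k]
  show ?thesis
  proof eventually_elim
    case (elim n)
    have "(\<integral>\<omega>. \<phi> k (W n \<omega>) \<partial>M) \<le> (\<integral>\<omega>. f n (W n \<omega>) \<partial>M)"
      by (intro integral_mono M.integrable_bounded_real[of _ B] \<phi>W meas \<phi>_bound bound \<phi>_le elim)
    with elim show ?case by simp
  qed
qed

text \<open>Continuous convergence survives composition with a bounded continuous \<open>h\<close>,
  so the lower estimate applies to \<open>h\<close> and to \<open>- h\<close>; together they give
  both sides of the limit. Measurability is asked of the compositions only, since \<open>g n\<close>
  itself may be discontinuous.\<close>

theorem conv_in_law_extended_continuous_mapping:
  fixes W :: "nat \<Rightarrow> 'a \<Rightarrow> 'b::metric_space" and g :: "nat \<Rightarrow> 'b \<Rightarrow> 'd::metric_space"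
  assumes prob: "prob_space M" "prob_space N"
    and conv: "conv_in_law M W N L"
    and meas: "\<And>n. (\<lambda>\<omega>. g n (W n \<omega>)) \<in> borel_measurable M"
    and lim: "\<And>w. ((\<lambda>(n, w'). g n w') \<longlongrightarrow> G w) (sequentially \<times>\<^sub>F nhds w)"
    and cont: "continuous_on UNIV G"
  shows "conv_in_law M (\<lambda>n \<omega>. g n (W n \<omega>)) N (\<lambda>\<omega>. G (L \<omega>))"
proof -
  have Gm: "(\<lambda>\<omega>. G (L \<omega>)) \<in> borel_measurable N"
    using conv measurable_compose[OF _ borel_measurable_continuous_onI[OF cont]]
    by (auto simp: conv_in_law_def)
  have "(\<lambda>n. \<integral>\<omega>. h (g n (W n \<omega>)) \<partial>M) \<longlonglongrightarrow> (\<integral>\<omega>. h (G (L \<omega>)) \<partial>N)"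
    if h: "continuous_on UNIV h" "bounded (range h)" for h :: "'d \<Rightarrow> real"
  proof -
    obtain B where B: "\<And>x. \<bar>h x\<bar> \<le> B"
      using h(2) by (auto simp: bounded_iff)
    have lower: "\<forall>\<^sub>F n in sequentially.
        (\<integral>\<omega>. k (G (L \<omega>)) \<partial>N) - e < (\<integral>\<omega>. k (g n (W n \<omega>)) \<partial>M)"
      if k: "continuous_on UNIV k" "\<And>x. \<bar>k x\<bar> \<le> B" and e: "e > 0" for k :: "'d \<Rightarrow> real" and e
    proof (rule conv_in_law_extended_lower[where f = "\<lambda>n w. k (g n w)" and g = "\<lambda>w. k (G w)",
          OF prob conv _ _ _ _ e])
      show "(\<lambda>\<omega>. k (g n (W n \<omega>))) \<in> borel_measurable M" for n
        using measurable_compose[OF meas borel_measurable_continuous_onI[OF k(1)]] .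
      show "(\<lambda>\<omega>. k (G (L \<omega>))) \<in> borel_measurable N"
        using measurable_compose[OF Gm borel_measurable_continuous_onI[OF k(1)]] .
      show "((\<lambda>(n, w'). k (g n w')) \<longlongrightarrow> k (G w)) (sequentially \<times>\<^sub>F nhds w)" for w
        using continuous_on_tendsto_compose[OF k(1) lim[of w]] by (simp add: case_prod_unfold)
    qed (rule k(2))
    show ?thesis
    proof (rule tendstoI)
      fix e :: real assume e: "e > 0"
      have "\<forall>\<^sub>F n in sequentially.
          (\<integral>\<omega>. - h (G (L \<omega>)) \<partial>N) - e < (\<integral>\<omega>. - h (g n (W n \<omega>)) \<partial>M)"
        using h(1) B e by (intro lower continuous_on_minus) auto
      with lower[OF h(1) B e]
      show "\<forall>\<^sub>F n in sequentially. dist (\<integral>\<omega>. h (g n (W n \<omega>)) \<partial>M) (\<integral>\<omega>. h (G (L \<omega>)) \<partial>N) < e"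
        by eventually_elim (simp add: dist_real_def abs_less_iff)
    qed
  qed
  with meas Gm show ?thesis
    by (simp add: conv_in_law_def)
qed

subsection \<open>Sample paths\<close>

lemma apply_to_C01:
  assumes "continuous_on {0..1} f"
  shows "apply_bcontfun (to_C01 f) s = f (of_ui s)"
  using eval_to_C01[OF assms of_ui] by (simp add: eval_C01_def of_ui_inverse)

lemma dist_to_C01_le:
  assumes "continuous_on {0..1} f" "continuous_on {0..1} g"
    and "\<And>t. t \<in> {0..1} \<Longrightarrow> \<bar>f t - g t\<bar> \<le> b"
  shows "dist (to_C01 f) (to_C01 g) \<le> b"
  by (rule dist_bound) (use assms(3)[OF of_ui] in \<open>simp add: apply_to_C01 assms(1,2) dist_real_def\<close>)

subsection \<open>Uniformly differentiable parametric families\<close>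

text \<open>The suprema are taken in \<open>ereal\<close>, so an unbounded gradient difference gives
  infinity instead of an unspecified real supremum.\<close>

locale uniformly_differentiable_family =
  fixes \<O> :: "'e::euclidean_space set"
    and A :: "'e \<Rightarrow> real \<Rightarrow> real"
    and Adot :: "'e \<Rightarrow> real \<Rightarrow> 'e"
  assumes path_continuous: "\<And>\<eta>. \<eta> \<in> \<O> \<Longrightarrow> continuous_on {0..1} (A \<eta>)"
    and open_param: "open \<O>"
    and gradient: "\<And>\<eta> t. \<eta> \<in> \<O> \<Longrightarrow> t \<in> {0..1} \<Longrightarrow> GDERIV (\<lambda>\<eta>'. A \<eta>' t) \<eta> :> Adot \<eta> t"
    and gradient_continuous: "\<And>\<eta>. \<eta> \<in> \<O> \<Longrightarrow>
      ((\<lambda>\<epsilon>. SUP \<eta>'\<in>{\<eta>' \<in> \<O>. norm (\<eta>' - \<eta>) < \<epsilon>}. SUP t\<in>{0..1}.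
          ereal (norm (Adot \<eta>' t - Adot \<eta> t))) \<longlongrightarrow> 0) (at_right 0)"
begin

section \<open>First-order expansion in the parameter, uniform in \<open>t\<close>\<close>

lemma gradient_close:
  assumes "\<eta> \<in> \<O>" "e > 0"
  obtains d where "d > 0" "ball \<eta> d \<subseteq> \<O>"
    "\<And>\<eta>' t. \<eta>' \<in> ball \<eta> d \<Longrightarrow> t \<in> {0..1} \<Longrightarrow> norm (Adot \<eta>' t - Adot \<eta> t) \<le> e"
proof -
  obtain r where r: "r > 0" "ball \<eta> r \<subseteq> \<O>"
    using open_param assms(1) by (meson openE)
  have "\<forall>\<^sub>F \<epsilon> in at_right 0. (SUP \<eta>'\<in>{\<eta>' \<in> \<O>. norm (\<eta>' - \<eta>) < \<epsilon>}. SUP t\<in>{0..1}.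
          ereal (norm (Adot \<eta>' t - Adot \<eta> t))) < ereal e"
    by (rule order_tendstoD(2)[OF gradient_continuous]) (use assms in auto)
  then obtain b where b: "b > 0" "\<And>\<epsilon>. 0 < \<epsilon> \<Longrightarrow> \<epsilon> < b \<Longrightarrow>
      (SUP \<eta>'\<in>{\<eta>' \<in> \<O>. norm (\<eta>' - \<eta>) < \<epsilon>}. SUP t\<in>{0..1}.
          ereal (norm (Adot \<eta>' t - Adot \<eta> t))) < ereal e"
    by (auto simp: eventually_at_right_field)
  \<comment> \<open>The supremum bound holds for radii strictly below \<open>b\<close>, hence the
    half; the minimum with \<open>r\<close> keeps the ball inside \<open>\<O>\<close>.\<close>
  define d where "d = min r (b / 2)"
  have d: "0 < d" "d < b" "d \<le> r"
    using r b(1) by (auto simp: d_def)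
  show thesis
  proof (rule that[OF d(1)])
    show sub: "ball \<eta> d \<subseteq> \<O>"
      using r(2) d(3) by (meson order_trans subset_ball)
    fix \<eta>' t assume *: "\<eta>' \<in> ball \<eta> d" "t \<in> {0..1::real}"
    have "ereal (norm (Adot \<eta>' t - Adot \<eta> t)) \<le> (SUP t\<in>{0..1}. ereal (norm (Adot \<eta>' t - Adot \<eta> t)))"
      using *(2) by (rule SUP_upper)
    also have "\<dots> \<le> (SUP \<eta>'\<in>{\<eta>' \<in> \<O>. norm (\<eta>' - \<eta>) < d}. SUP t\<in>{0..1}.
          ereal (norm (Adot \<eta>' t - Adot \<eta> t)))"
      by (rule SUP_upper) (use * sub in \<open>auto simp: dist_norm norm_minus_commute\<close>)
    also have "\<dots> < ereal e"
      using d by (intro b)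
    finally show "norm (Adot \<eta>' t - Adot \<eta> t) \<le> e" by simp
  qed
qed

text \<open>Mean value inequality on a ball, which is convex: once the linear part at
  \<open>\<eta>\<close> is subtracted, the remaining gradient is
  \<open>Adot \<eta>' t - Adot \<eta> t\<close>, of norm at most \<open>e\<close>. The radius is
  free of \<open>t\<close> because the one in \<open>gradient_close\<close> is.\<close>

lemma uniform_expansion:
  assumes "\<eta> \<in> \<O>" "e > 0"
  obtains d where "d > 0"
    "\<And>h. norm h < d \<Longrightarrow> \<eta> + h \<in> \<O>"
    "\<And>h t. norm h < d \<Longrightarrow> t \<in> {0..1} \<Longrightarrow> \<bar>A (\<eta> + h) t - A \<eta> t - Adot \<eta> t \<bullet> h\<bar> \<le> e * norm h"
proof -
  obtain d where d: "d > 0" "ball \<eta> d \<subseteq> \<O>"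
    "\<And>\<eta>' t. \<eta>' \<in> ball \<eta> d \<Longrightarrow> t \<in> {0..1} \<Longrightarrow> norm (Adot \<eta>' t - Adot \<eta> t) \<le> e"
    using gradient_close[OF assms] by blast
  show thesis
  proof (rule that[OF d(1)])
    show "\<eta> + h \<in> \<O>" if "norm h < d" for h
      using d(2) that by (auto simp: dist_norm)
    fix h :: 'e and t :: real
    assume h: "norm h < d" and t: "t \<in> {0..1}"
    let ?F = "\<lambda>\<eta>'. A \<eta>' t - Adot \<eta> t \<bullet> \<eta>'"
    have "norm (?F (\<eta> + h) - ?F \<eta>) \<le> e * norm (\<eta> + h - \<eta>)"
    proof (rule differentiable_bound[of "ball \<eta> d" ?F "\<lambda>\<eta>' k. (Adot \<eta>' t - Adot \<eta> t) \<bullet> k"])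
      fix \<eta>' assume \<eta>': "\<eta>' \<in> ball \<eta> d"
      have "((\<lambda>\<eta>'. A \<eta>' t) has_derivative (\<lambda>k. Adot \<eta>' t \<bullet> k)) (at \<eta>')"
        using gradient[of \<eta>' t] d(2) \<eta>' t by (auto simp: gderiv_def inner_commute)
      then have "((\<lambda>\<eta>'. A \<eta>' t) has_derivative (\<lambda>k. Adot \<eta>' t \<bullet> k)) (at \<eta>' within ball \<eta> d)"
        by (rule has_derivative_at_withinI)
      then show "(?F has_derivative (\<lambda>k. (Adot \<eta>' t - Adot \<eta> t) \<bullet> k)) (at \<eta>' within ball \<eta> d)"
        by (auto intro!: derivative_eq_intros simp: inner_diff_left)
      show "onorm (\<lambda>k. (Adot \<eta>' t - Adot \<eta> t) \<bullet> k) \<le> e"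
      proof (rule onorm_le)
        fix k
        have "norm ((Adot \<eta>' t - Adot \<eta> t) \<bullet> k) \<le> norm (Adot \<eta>' t - Adot \<eta> t) * norm k"
          using Cauchy_Schwarz_ineq2 by auto
        also have "\<dots> \<le> e * norm k"
          using d(3)[OF \<eta>' t] by (simp add: mult_right_mono)
        finally show "norm ((Adot \<eta>' t - Adot \<eta> t) \<bullet> k) \<le> e * norm k" .
      qed
    qed (use d(1) h in \<open>auto simp: dist_norm\<close>)
    then show "\<bar>A (\<eta> + h) t - A \<eta> t - Adot \<eta> t \<bullet> h\<bar> \<le> e * norm h"
      by (simp add: inner_add_right algebra_simps)
  qed
qed

text \<open>The gradient is a uniform limit of difference quotients, which are continuous in \<open>t\<close>.\<close>

lemma gradient_path_continuous:
  assumes "\<eta> \<in> \<O>"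
  shows "continuous_on {0..1} (Adot \<eta>)"
proof -
  have "continuous_on {0..1} (\<lambda>t. Adot \<eta> t \<bullet> b)" if b: "b \<in> Basis" for b
  proof (rule uniform_limit_theorem)
    let ?q = "\<lambda>s t. (A (\<eta> + s *\<^sub>R b) t - A \<eta> t) / s"
    have nb: "norm b = 1" using b by simp
    obtain d where d: "d > 0" "\<And>h. norm h < d \<Longrightarrow> \<eta> + h \<in> \<O>"
      using uniform_expansion[OF assms zero_less_one] by metis
    \<comment> \<open>Continuity of the quotient is available for \<open>s\<close> below
      \<open>d\<close>, where the shifted parameter is still in \<open>\<O>\<close>.\<close>
    show "\<forall>\<^sub>F s in at_right 0. continuous_on {0..1} (?q s)"
      using eventually_at_right_real[OF d(1)]
    proof eventually_elim
      case (elim s)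
      then show ?case
        using d(2)[of "s *\<^sub>R b"] nb assms by (intro continuous_intros path_continuous) auto
    qed
    show "uniform_limit {0..1} ?q (\<lambda>t. Adot \<eta> t \<bullet> b) (at_right 0)"
    proof (rule uniform_limitI)
      fix e :: real assume "e > 0"
      then obtain d where d: "d > 0" and ex: "\<And>h t. norm h < d \<Longrightarrow> t \<in> {0..1} \<Longrightarrow>
          \<bar>A (\<eta> + h) t - A \<eta> t - Adot \<eta> t \<bullet> h\<bar> \<le> e / 2 * norm h"
        using uniform_expansion[OF assms, of "e / 2"] by (metis half_gt_zero)
      show "\<forall>\<^sub>F s in at_right 0. \<forall>t\<in>{0..1}. dist (?q s t) (Adot \<eta> t \<bullet> b) < e"
        using eventually_at_right_real[OF d]
      proof (eventually_elim, intro ballI)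
        fix s t :: real assume s: "s \<in> {0<..<d}" and t: "t \<in> {0..1}"
        have "?q s t - Adot \<eta> t \<bullet> b = (A (\<eta> + s *\<^sub>R b) t - A \<eta> t - Adot \<eta> t \<bullet> (s *\<^sub>R b)) / s"
          using s by (simp add: field_simps)
        moreover have "\<bar>A (\<eta> + s *\<^sub>R b) t - A \<eta> t - Adot \<eta> t \<bullet> (s *\<^sub>R b)\<bar> \<le> e / 2 * s"
          using ex[of "s *\<^sub>R b" t] s t nb by simp
        ultimately have "dist (?q s t) (Adot \<eta> t \<bullet> b) \<le> e / 2"
          using s by (simp add: dist_real_def divide_simps mult.commute)
        then show "dist (?q s t) (Adot \<eta> t \<bullet> b) < e"
          using \<open>e > 0\<close> by simp
      qed
    qed
  qed simp
  then show ?thesis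
    by (subst continuous_on_componentwise) auto
qed

section \<open>The family and its derivative as continuous maps into the path space\<close>

lemma gradient_bounded:
  assumes "\<eta> \<in> \<O>"
  obtains K where "K > 0" "\<And>t h. t \<in> {0..1} \<Longrightarrow> \<bar>Adot \<eta> t \<bullet> h\<bar> \<le> K * norm h"
proof -
  have "bounded (Adot \<eta> ` {0..1})"
    by (intro compact_imp_bounded compact_continuous_image gradient_path_continuous assms) simp
  then obtain K where K: "K > 0" "\<And>t. t \<in> {0..1} \<Longrightarrow> norm (Adot \<eta> t) \<le> K"
    by (auto simp: bounded_pos)
  show thesis
    by (rule that[OF K(1)])
      (meson Cauchy_Schwarz_ineq2 K(2) mult_right_mono norm_ge_zero order_trans)
qed

text \<open>Near \<open>\<eta>\<close>, the expansion with error \<open>1 * norm h\<close> and the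
  gradient bound \<open>K\<close> give the estimate with factor \<open>1 + K\<close>. The lemma
  later supplies measurability of the plugged-in paths.\<close>

lemma continuous_on_to_C01_param: "continuous_on \<O> (\<lambda>\<eta>. to_C01 (A \<eta>))"
proof (clarsimp simp: continuous_on_iff)
  fix \<eta> and e :: real assume \<eta>: "\<eta> \<in> \<O>" and e: "e > 0"
  obtain K where K: "K > 0" "\<And>t h. t \<in> {0..1} \<Longrightarrow> \<bar>Adot \<eta> t \<bullet> h\<bar> \<le> K * norm h"
    using gradient_bounded[OF \<eta>] by blast
  obtain d where d: "d > 0" and ex: "\<And>h t. norm h < d \<Longrightarrow> t \<in> {0..1} \<Longrightarrow>
      \<bar>A (\<eta> + h) t - A \<eta> t - Adot \<eta> t \<bullet> h\<bar> \<le> 1 * norm h"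
    using uniform_expansion[OF \<eta> zero_less_one] by metis
  show "\<exists>d>0. \<forall>\<eta>'\<in>\<O>. dist \<eta>' \<eta> < d \<longrightarrow> dist (to_C01 (A \<eta>')) (to_C01 (A \<eta>)) < e"
  proof (intro exI[of _ "min d (e / (1 + K))"] conjI ballI impI)
    fix \<eta>' assume \<eta>': "\<eta>' \<in> \<O>" and close: "dist \<eta>' \<eta> < min d (e / (1 + K))"
    have "dist (to_C01 (A \<eta>')) (to_C01 (A \<eta>)) \<le> (1 + K) * dist \<eta>' \<eta>"
    proof (rule dist_to_C01_le)
      fix t :: real assume t: "t \<in> {0..1}"
      show "\<bar>A \<eta>' t - A \<eta> t\<bar> \<le> (1 + K) * dist \<eta>' \<eta>"
        using ex[of "\<eta>' - \<eta>" t] K(2)[OF t, of "\<eta>' - \<eta>"] close t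
        by (simp add: dist_norm distrib_right)
    qed (use \<eta> \<eta>' path_continuous in auto)
    also have "\<dots> < e"
      using close K(1) by (simp add: field_simps)
    finally show "dist (to_C01 (A \<eta>')) (to_C01 (A \<eta>)) < e" .
  qed (use d e K(1) in auto)
qed

text \<open>The map is linear in \<open>h\<close> with operator bound \<open>K\<close>, hence
  Lipschitz. Continuity of the gradient path ensures that \<open>to_C01\<close> is applied to a
  genuine continuous function.\<close>

lemma continuous_on_to_C01_gradient:
  assumes "\<eta> \<in> \<O>"
  shows "continuous_on UNIV (\<lambda>h. to_C01 (\<lambda>t. Adot \<eta> t \<bullet> h))"
proof -
  obtain K where K: "K > 0" "\<And>t h. t \<in> {0..1} \<Longrightarrow> \<bar>Adot \<eta> t \<bullet> h\<bar> \<le> K * norm h"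
    using gradient_bounded[OF assms] by blast
  show ?thesis
  proof (rule lipschitz_on_continuous_on[of K], rule lipschitz_onI)
    show "dist (to_C01 (\<lambda>t. Adot \<eta> t \<bullet> h)) (to_C01 (\<lambda>t. Adot \<eta> t \<bullet> k)) \<le> K * dist h k" for h k
      by (rule dist_to_C01_le)
        (use K(2)[of _ "h - k"] in \<open>auto intro!: continuous_intros gradient_path_continuous assms
          simp: dist_norm inner_diff_right\<close>)
  qed (use K(1) in simp)
qed

section \<open>Rescaled increments and their continuous convergence\<close>

text \<open>Outside the domain of the reparametrised family the value is irrelevant.\<close>

definition local_increment :: "'e \<Rightarrow> nat \<Rightarrow> 'e \<Rightarrow> C01" where
  "local_increment \<eta> n h = (let \<eta>' = \<eta> + h /\<^sub>R sqrt (real n) in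
    if \<eta>' \<in> \<O> then sqrt (real n) *\<^sub>R (to_C01 (A \<eta>') - to_C01 (A \<eta>)) else 0)"

text \<open>The factor \<open>sqrt n\<close> cancels the shrinking step: an expansion error
  \<open>c * norm (h' / sqrt n)\<close> becomes \<open>c * norm h'\<close>, which is small because
  \<open>h'\<close> stays bounded near \<open>h\<close>.\<close>

lemma local_increment_tendsto:
  assumes \<eta>: "\<eta> \<in> \<O>"
  shows "((\<lambda>(n, h'). local_increment \<eta> n h') \<longlongrightarrow> to_C01 (\<lambda>t. Adot \<eta> t \<bullet> h))
    (sequentially \<times>\<^sub>F nhds h)"
proof -
  let ?F = "sequentially \<times>\<^sub>F nhds h"
  let ?D = "\<lambda>h. to_C01 (\<lambda>t. Adot \<eta> t \<bullet> h)"
  have snd: "(snd \<longlongrightarrow> h) ?F"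
    by (rule filterlim_snd)
  have Dcont: "((\<lambda>p. ?D (snd p)) \<longlongrightarrow> ?D h) ?F"
    using continuous_on_tendsto_compose[OF continuous_on_to_C01_gradient[OF \<eta>] snd] by simp
  have "(\<lambda>n. inverse (sqrt (real n))) \<longlonglongrightarrow> 0"
    by (intro tendsto_inverse_0_at_top filterlim_compose[OF sqrt_at_top] filterlim_real_sequentially)
  then have "((\<lambda>p. inverse (sqrt (real (fst p)))) \<longlongrightarrow> 0) ?F"
    by (rule filterlim_compose) (rule filterlim_fst)
  from tendsto_scaleR[OF this snd]
  have small: "((\<lambda>p. snd p /\<^sub>R sqrt (real (fst p))) \<longlongrightarrow> 0) ?F" by simp
  \<comment> \<open>The comparison is first made with the derivative in the moving direction
    \<open>snd p\<close>; \<open>Dcont\<close> then replaces that direction by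
    \<open>h\<close>.\<close>
  have "((\<lambda>p. local_increment \<eta> (fst p) (snd p) - ?D (snd p)) \<longlongrightarrow> 0) ?F"
  proof (rule tendstoI)
    fix e :: real assume e: "e > 0"
    \<comment> \<open>Directions near \<open>h\<close> have norm below \<open>norm h + 1\<close>, so
      the error \<open>c * norm k\<close> stays below \<open>e\<close>; the denominator is positive
      even for \<open>h = 0\<close>.\<close>
    define c where "c = e / (norm h + 2)"
    have c: "c > 0" using e by (simp add: c_def add_nonneg_pos)
    obtain d where d: "d > 0" "\<And>h. norm h < d \<Longrightarrow> \<eta> + h \<in> \<O>"
      and ex: "\<And>h t. norm h < d \<Longrightarrow> t \<in> {0..1} \<Longrightarrow>
        \<bar>A (\<eta> + h) t - A \<eta> t - Adot \<eta> t \<bullet> h\<bar> \<le> c * norm h"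
      using uniform_expansion[OF \<eta> c] by metis
    have "\<forall>\<^sub>F p in ?F. norm (snd p /\<^sub>R sqrt (real (fst p))) < d"
      using tendstoD[OF small d(1)] by simp
    moreover have "\<forall>\<^sub>F p in ?F. norm (snd p) < norm h + 1"
      using order_tendstoD(2)[OF tendsto_norm[OF snd], of "norm h + 1"] by simp
    \<comment> \<open>This excludes \<open>n = 0\<close>, where the division by
      \<open>sqrt n\<close> takes its default value 0.\<close>
    moreover have "\<forall>\<^sub>F p in ?F. fst p \<ge> 1"
      using filterlim_fst[of sequentially "nhds h"] eventually_ge_at_top[of "1::nat"]
      by (auto simp: filterlim_iff)
    ultimately show "\<forall>\<^sub>F p in ?F. dist (local_increment \<eta> (fst p) (snd p) - ?D (snd p)) 0 < e"
    proof eventually_elim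
      case (elim p)
      define n k s where "n = fst p" and "k = snd p" and "s = sqrt (real n)"
      have s: "s > 0" using elim(3) by (simp add: s_def n_def)
      have ks: "norm (k /\<^sub>R s) < d" and O': "\<eta> + k /\<^sub>R s \<in> \<O>"
        using elim(1) d(2) by (auto simp: n_def k_def s_def)
      have cont: "continuous_on {0..1} (\<lambda>t. s * (A (\<eta> + k /\<^sub>R s) t - A \<eta> t))"
        by (intro continuous_intros path_continuous \<eta> O')
      have "local_increment \<eta> n k = to_C01 (\<lambda>t. s * (A (\<eta> + k /\<^sub>R s) t - A \<eta> t))"
        by (rule bcontfun_eqI)
          (use O' \<eta> in \<open>simp add: local_increment_def s_def[symmetric] apply_to_C01 cont path_continuous\<close>)
      then have "dist (local_increment \<eta> n k - ?D k) 0
          = dist (to_C01 (\<lambda>t. s * (A (\<eta> + k /\<^sub>R s) t - A \<eta> t))) (?D k)"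
        by (simp add: dist_norm)
      also have "\<dots> \<le> c * norm k"
      proof (rule dist_to_C01_le[OF cont])
        show "continuous_on {0..1} (\<lambda>t. Adot \<eta> t \<bullet> k)"
          by (intro continuous_intros gradient_path_continuous \<eta>)
        fix t :: real assume t: "t \<in> {0..1}"
        have "s * (A (\<eta> + k /\<^sub>R s) t - A \<eta> t) - Adot \<eta> t \<bullet> k
            = s * (A (\<eta> + k /\<^sub>R s) t - A \<eta> t - Adot \<eta> t \<bullet> (k /\<^sub>R s))"
          using s by (simp add: field_simps)
        then have "\<bar>s * (A (\<eta> + k /\<^sub>R s) t - A \<eta> t) - Adot \<eta> t \<bullet> k\<bar>
            = s * \<bar>A (\<eta> + k /\<^sub>R s) t - A \<eta> t - Adot \<eta> t \<bullet> (k /\<^sub>R s)\<bar>"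
          using s by (simp add: abs_mult)
        also have "\<dots> \<le> s * (c * norm (k /\<^sub>R s))"
          using s by (intro mult_left_mono ex ks t) simp
        also have "\<dots> = c * norm k"
          using s by simp
        finally show "\<bar>s * (A (\<eta> + k /\<^sub>R s) t - A \<eta> t) - Adot \<eta> t \<bullet> k\<bar> \<le> c * norm k" .
      qed
      also have "\<dots> < c * (norm h + 2)"
        using c elim(2) by (simp add: k_def)
      also have "\<dots> = e"
        using add_nonneg_pos[OF norm_ge_zero[of h], of 2] by (simp add: c_def)
      finally show ?case by (simp add: n_def k_def)
    qed
  qed
  from tendsto_add[OF this Dcont] show ?thesis
    by (simp add: case_prod_unfold)
qed

section \<open>Weak convergence with the parameter estimated\<close>

text \<open>Since the estimate equals \<open>\<theta>0\<close> plus its rescaled error divided by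
  \<open>sqrt n\<close>, the wanted process is exactly a function \<open>g n\<close> of the pair
  whose convergence is assumed. The nonparametric estimator \<open>E\<close> is left abstract so
  that both cases are instances.\<close>

theorem plug_in_conv_in_law:
  fixes E :: "nat \<Rightarrow> 'a \<Rightarrow> real \<Rightarrow> real" and \<theta> :: "nat \<Rightarrow> 'a \<Rightarrow> 'e"
  assumes prob: "prob_space M" "prob_space N"
    and \<theta>0: "\<theta>0 \<in> \<O>"
    and E: "\<And>n \<omega>. continuous_on {0..1} (E n \<omega>)"
    and \<theta>: "\<And>n \<omega>. n \<ge> 1 \<Longrightarrow> \<omega> \<in> space M \<Longrightarrow> \<theta> n \<omega> \<in> \<O>"
    and conv: "conv_in_law M
        (\<lambda>n \<omega>. (to_C01 (\<lambda>t. sqrt (real n) * (E n \<omega> t - A \<theta>0 t)), sqrt (real n) *\<^sub>R (\<theta> n \<omega> - \<theta>0)))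
        N (\<lambda>\<omega>. (Z \<omega>, H \<omega>))"
  shows "conv_in_law M (\<lambda>n \<omega>. to_C01 (\<lambda>t. sqrt (real n) * (E n \<omega> t - A (\<theta> n \<omega>) t)))
      N (\<lambda>\<omega>. Z \<omega> - to_C01 (\<lambda>t. Adot \<theta>0 t \<bullet> H \<omega>))"
proof -
  define W where "W n \<omega> =
    (to_C01 (\<lambda>t. sqrt (real n) * (E n \<omega> t - A \<theta>0 t)), sqrt (real n) *\<^sub>R (\<theta> n \<omega> - \<theta>0))" for n \<omega>
  define g where "g n w = fst w - local_increment \<theta>0 n (snd w)" for n and w :: "C01 \<times> 'e"
  define G where "G w = fst w - to_C01 (\<lambda>t. Adot \<theta>0 t \<bullet> snd w)" for w
  have W: "conv_in_law M W N (\<lambda>\<omega>. (Z \<omega>, H \<omega>))"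
    using conv by (simp add: W_def[abs_def])
  have Wm: "W n \<in> borel_measurable M" for n
    using W by (auto simp: conv_in_law_def)
  \<comment> \<open>The identity is restricted to \<open>space M\<close>, where for
    \<open>n \<ge> 1\<close> the estimate lies in \<open>\<O>\<close> and
    \<open>local_increment\<close> takes its meaningful branch.\<close>
  have eq: "to_C01 (\<lambda>t. sqrt (real n) * (E n \<omega> t - A (\<theta> n \<omega>) t)) = g n (W n \<omega>)"
    if \<omega>: "\<omega> \<in> space M" for n \<omega>
  proof (cases "n = 0")
    \<comment> \<open>Nothing is known about \<open>\<theta> 0 \<omega>\<close>, but the factor
      \<open>sqrt 0\<close> makes both sides the zero path.\<close>
    case True
    have "to_C01 (\<lambda>_. 0) = 0"
      by (rule bcontfun_eqI) (simp add: apply_to_C01)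
    with True show ?thesis
      by (simp add: g_def W_def local_increment_def Let_def)
  next
    case False
    then have O': "\<theta> n \<omega> \<in> \<O>" using \<theta>[OF _ \<omega>] by simp
    have sh: "\<theta>0 + (sqrt (real n) *\<^sub>R (\<theta> n \<omega> - \<theta>0)) /\<^sub>R sqrt (real n) = \<theta> n \<omega>"
      using False by simp
    have c: "continuous_on {0..1} (\<lambda>t. sqrt (real n) * (E n \<omega> t - A \<eta> t))" if "\<eta> \<in> \<O>" for \<eta>
      using that by (intro continuous_intros E path_continuous)
    have "local_increment \<theta>0 n (sqrt (real n) *\<^sub>R (\<theta> n \<omega> - \<theta>0))
        = sqrt (real n) *\<^sub>R (to_C01 (A (\<theta> n \<omega>)) - to_C01 (A \<theta>0))"
      unfolding local_increment_def Let_def sh using O' by simp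
    then show ?thesis
      by (intro bcontfun_eqI)
        (use O' \<theta>0 in \<open>simp add: g_def W_def apply_to_C01 c path_continuous flip: right_diff_distrib\<close>)
  qed
  have gm: "(\<lambda>\<omega>. g n (W n \<omega>)) \<in> borel_measurable M" for n
  proof (cases "n = 0")
    case True
    then have "(\<lambda>\<omega>. g n (W n \<omega>)) = (\<lambda>\<omega>. fst (W n \<omega>))"
      by (simp add: g_def local_increment_def Let_def)
    moreover have "(\<lambda>\<omega>. fst (W n \<omega>)) \<in> borel_measurable M"
      using measurable_compose[OF Wm borel_measurable_continuous_onI[OF continuous_on_fst[OF continuous_on_id]]] .
    ultimately show ?thesis by simp
  next
    case False
    \<comment> \<open>The two branches of \<open>g n\<close> need not fit together continuously at
      the edge of \<open>S\<close>. On \<open>S\<close> it is continuous, and \<open>W n\<close>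
      maps \<open>space M\<close> into \<open>S\<close>, so measurability on the restricted space
      suffices; \<open>W n\<close> enters as one Borel map into the product.\<close>
    define S where "S = {w :: C01 \<times> 'e. \<theta>0 + snd w /\<^sub>R sqrt (real n) \<in> \<O>}"
    have "continuous_on S (\<lambda>w. to_C01 (A (\<theta>0 + snd w /\<^sub>R sqrt (real n))))"
      by (rule continuous_on_compose2[OF continuous_on_to_C01_param])
        (auto simp: S_def intro!: continuous_intros)
    then have "continuous_on S (\<lambda>w. fst w - sqrt (real n) *\<^sub>R
        (to_C01 (A (\<theta>0 + snd w /\<^sub>R sqrt (real n))) - to_C01 (A \<theta>0)))"
      by (intro continuous_intros)
    then have "continuous_on S (g n)"
      by (rule continuous_on_eq) (simp add: S_def g_def local_increment_def Let_def)
    moreover have "W n \<in> measurable M (restrict_space borel S)"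
      by (rule measurable_restrict_space2)
        (use Wm False \<theta> in \<open>auto simp: W_def S_def\<close>)
    ultimately show ?thesis
      using measurable_compose borel_measurable_continuous_on_restrict by blast
  qed
  have "conv_in_law M (\<lambda>n \<omega>. g n (W n \<omega>)) N (\<lambda>\<omega>. G (Z \<omega>, H \<omega>))"
  proof (rule conv_in_law_extended_continuous_mapping[OF prob W gm])
    show "continuous_on UNIV G"
      unfolding G_def
      by (intro continuous_intros continuous_on_compose2[OF continuous_on_to_C01_gradient[OF \<theta>0]]) auto
    fix w :: "C01 \<times> 'e"
    obtain z h where w: "w = (z, h)" by (cases w)
    have snd: "filterlim snd (nhds (z, h)) (sequentially \<times>\<^sub>F nhds w)"
      unfolding w by (rule filterlim_snd)
    \<comment> \<open>Dropping the path component \<open>z\<close> turns the joint limit into the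
      one covered by \<open>local_increment_tendsto\<close>.\<close>
    have n: "filterlim (\<lambda>p. (fst p, snd (snd p))) (sequentially \<times>\<^sub>F nhds h) (sequentially \<times>\<^sub>F nhds w)"
      using tendsto_snd[OF snd] by (intro filterlim_Pair filterlim_fst) simp
    have "((\<lambda>p. local_increment \<theta>0 (fst p) (snd (snd p))) \<longlongrightarrow> to_C01 (\<lambda>t. Adot \<theta>0 t \<bullet> h))
        (sequentially \<times>\<^sub>F nhds w)"
      using filterlim_compose[OF local_increment_tendsto[OF \<theta>0] n] by simp
    moreover have "((\<lambda>p. fst (snd p)) \<longlongrightarrow> z) (sequentially \<times>\<^sub>F nhds w)"
      using tendsto_fst[OF snd] by simp
    ultimately show "((\<lambda>(n, w'). g n w') \<longlongrightarrow> G w) (sequentially \<times>\<^sub>F nhds w)"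
      unfolding g_def G_def split_beta w fst_conv snd_conv by (intro tendsto_diff)
  qed
  moreover have "(\<lambda>\<omega>. to_C01 (\<lambda>t. sqrt (real n) * (E n \<omega> t - A (\<theta> n \<omega>) t))) \<in> borel_measurable M" for n
    using gm[of n] by (simp add: eq cong: measurable_cong)
  ultimately show ?thesis
    by (simp add: conv_in_law_def G_def eq cong: Bochner_Integration.integral_cong)
qed

end

section \<open>Application to the Pickands and CFG estimators\<close>

theorem proposition1:
  fixes M :: "'a measure"
    and N :: "'c measure"
    and \<O> :: "(real ^ 'p) set"
    and A :: "real ^ 'p \<Rightarrow> real \<Rightarrow> real"
    and Adot :: "real ^ 'p \<Rightarrow> real \<Rightarrow> real ^ 'p"
    and \<theta>0 :: "real ^ 'p"
    and X Y :: "nat \<Rightarrow> 'a \<Rightarrow> real"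
    and \<theta> :: "nat \<Rightarrow> 'a \<Rightarrow> real ^ 'p"
    and \<CC> :: "'c \<Rightarrow> linf_square"
    and AP ACFG :: "'c \<Rightarrow> C01"
    and \<Theta> :: "'c \<Rightarrow> real ^ 'p"
  defines "C \<equiv> copula_of M (X 1) (Y 1)"
    and "An_P \<equiv> \<lambda>n \<omega>. A_P n (\<lambda>i. X i \<omega>) (\<lambda>i. Y i \<omega>)"
    and "An_CFG \<equiv> \<lambda>n \<omega>. A_CFG n (\<lambda>i. X i \<omega>) (\<lambda>i. Y i \<omega>)"
    and "Cn \<equiv> \<lambda>n \<omega>. emp_copula n (\<lambda>i. X i \<omega>) (\<lambda>i. Y i \<omega>)"
    and "\<Theta>n \<equiv> \<lambda>n \<omega>. sqrt (real n) *\<^sub>R (\<theta> n \<omega> - \<theta>0)"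
  assumes family: "\<And>\<eta>. \<eta> \<in> \<O> \<Longrightarrow> pickands (A \<eta>)"
    and open_param: "open \<O>"
    and smooth: "\<And>\<eta>. \<eta> \<in> \<O> \<Longrightarrow> twice_cont_diff_on {0<..<1} (A \<eta>)"
    and gradient: "\<And>\<eta> t. \<eta> \<in> \<O> \<Longrightarrow> t \<in> {0..1} \<Longrightarrow> GDERIV (\<lambda>\<eta>'. A \<eta>' t) \<eta> :> Adot \<eta> t"
    and gradient_continuous: "\<And>\<eta>. \<eta> \<in> \<O> \<Longrightarrow>
      ((\<lambda>\<epsilon>. SUP \<eta>'\<in>{\<eta>' \<in> \<O>. norm (\<eta>' - \<eta>) < \<epsilon>}. SUP t\<in>{0..1}.
          ereal (norm (Adot \<eta>' t - Adot \<eta> t))) \<longlongrightarrow> 0) (at_right 0)"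
    and prob_M: "prob_space M"
    and sample_indep:
      "prob_space.indep_vars M (\<lambda>_. borel) (\<lambda>i \<omega>. (X i \<omega>, Y i \<omega>)) {1..}"
    and sample_ident: "\<And>i. i \<ge> 1 \<Longrightarrow>
      distr M borel (\<lambda>\<omega>. (X i \<omega>, Y i \<omega>)) = distr M borel (\<lambda>\<omega>. (X 1 \<omega>, Y 1 \<omega>))"
    and margins: "continuous_on UNIV (cdf (distr M borel (X 1)))"
      "continuous_on UNIV (cdf (distr M borel (Y 1)))"
    and true_param: "\<theta>0 \<in> \<O>"
    and copula: "extreme_value_copula C (A \<theta>0)"
    and est_rank_based: "rank_based M X Y \<theta>"
    and est_values: "\<And>n \<omega>. n \<ge> 1 \<Longrightarrow> \<omega> \<in> space M \<Longrightarrow> \<theta> n \<omega> \<in> \<O>"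
    and prob_N: "prob_space N"
    and limit_copula: "gaussian N \<CC>"
      "conv_in_law M
        (\<lambda>n \<omega>. to_linf_square (\<lambda>u v. sqrt (real n) * (Cn n \<omega> u v - C u v))) N \<CC>"
    and limit_P: "AE \<omega> in N. \<forall>t\<in>{0..1}. eval_C01 (AP \<omega>) t =
      - (A \<theta>0 t)\<^sup>2 * (LBINT x:{0<..<1}. eval_linf_square (\<CC> \<omega>) (x powr (1 - t)) (x powr t) / x)"
    and limit_CFG: "AE \<omega> in N. \<forall>t\<in>{0..1}. eval_C01 (ACFG \<omega>) t =
      A \<theta>0 t * (LBINT x:{0<..<1}. eval_linf_square (\<CC> \<omega>) (x powr (1 - t)) (x powr t) / (x * ln x))"
  shows "(gaussian N (\<lambda>\<omega>. (AP \<omega>, \<Theta> \<omega>)) \<and>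
      conv_in_law M
        (\<lambda>n \<omega>. (to_C01 (\<lambda>t. sqrt (real n) * (An_P n \<omega> t - A \<theta>0 t)), \<Theta>n n \<omega>))
        N (\<lambda>\<omega>. (AP \<omega>, \<Theta> \<omega>))
      \<longrightarrow>
      conv_in_law M
        (\<lambda>n \<omega>. to_C01 (\<lambda>t. sqrt (real n) * (An_P n \<omega> t - A (\<theta> n \<omega>) t)))
        N (\<lambda>\<omega>. AP \<omega> - to_C01 (\<lambda>t. Adot \<theta>0 t \<bullet> \<Theta> \<omega>)))
    \<and>
    (gaussian N (\<lambda>\<omega>. (ACFG \<omega>, \<Theta> \<omega>)) \<and>
      conv_in_law M
        (\<lambda>n \<omega>. (to_C01 (\<lambda>t. sqrt (real n) * (An_CFG n \<omega> t - A \<theta>0 t)), \<Theta>n n \<omega>))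
        N (\<lambda>\<omega>. (ACFG \<omega>, \<Theta> \<omega>))
      \<longrightarrow>
      conv_in_law M
        (\<lambda>n \<omega>. to_C01 (\<lambda>t. sqrt (real n) * (An_CFG n \<omega> t - A (\<theta> n \<omega>) t)))
        N (\<lambda>\<omega>. ACFG \<omega> - to_C01 (\<lambda>t. Adot \<theta>0 t \<bullet> \<Theta> \<omega>)))"
proof -
  \<comment> \<open>Continuity of the paths \<open>A \<eta>\<close> up to the endpoints comes from
    the Pickands bounds through \<open>pickands_continuous\<close>. Both claims are then plug-in
    limits, with \<open>E\<close> the respective rank-based estimator.\<close>
  interpret uniformly_differentiable_family \<O> A Adot
    by unfold_locales
      (use family pickands_continuous open_param gradient gradient_continuous in auto)
  show ?thesis
    unfolding \<Theta>n_def An_P_def An_CFG_def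
    by (intro conjI impI plug_in_conv_in_law[OF prob_M prob_N true_param]
        A_P_continuous A_CFG_continuous est_values) auto
qed

end
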